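(* Let $H=(V,E)$ be a contextuality scenario and let $p:V\to[0,1]$ be a probabilistic model on $H$. Then $p$ is macroscopically non-contextual (i.e. there exists a macroscopic non-contextuality certificate for $p$) if and only if $p\in\mathcal{Q}_1(H)$ (i.e. there exists a $\mathcal{Q}_1$ certificate for $p$).
   Context: A contextuality scenario is a hypergraph $H=(V,E)$ with $V$ a finite nonempty set of vertices (events, i.e. measurement outcomes) and $E$ a set of subsets of $V$ called hyperedges (each hyperedge is the complete set of outcomes of one measurement), such that every vertex belongs to at least one hyperedge. Distinct hyperedges may intersect. A probabilistic model on $H$ (also called a behaviour) is a function $p:V\to[0,1]$ satisfying the normalisation condition $\sum_{v\in e}p(v)=1$ for every $e\in E$. Matrices below are real symmetric, and p.s.d. means positive semidefinite. $\mathcal{Q}_1$ certificate: for a probabilistic model $p$ on $H$, a $\mathcal{Q}_1$ certificate is a p.s.d. matrix $M$ with rows and columns indexed by $V\cup\{1\}$, where $1$ is a special index not in $V$, such that for all $e\in E$: (1) $\sum_{u\in e}M_{uv}=M_{1v}$ for all $v\in V$, and $\sum_{v\in e}M_{1v}=M_{11}$; (2) $M_{uv}=0$ for all $u,v\in e$ with $u\neq v$; (3) $M_{vv}=p(v)$ for all $v\in V$. The set $\mathcal{Q}_1(H)$ is the set of all probabilistic models on $H$ for which a $\mathcal{Q}_1$ certificate exists. Macroscopic non-contextuality certificate: for a probabilistic model $p$ on $H$, this is a p.s.d. matrix $\gamma$ with rows and columns indexed by $V$ such that: (i) $\sum_{u\in e}\gamma_{uv}=0$ for all $e\in E$ and all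 $v\in V$; (ii) $\gamma_{uv}=-p(u)p(v)$ whenever $u\neq v$ and there is some $e\in E$ with $u,v\in e$; (iii) $\gamma_{vv}=p(v)-p(v)^2$ for all $v\in V$. A probabilistic model is macroscopically non-contextual if a macroscopic non-contextuality certificate for it exists. *)

theory Defs
  imports "HOL-Analysis.Analysis"
begin

locale contextuality_scenario =
  fixes V :: "'a set" and E :: "'a set set"
  assumes finite_vertices: "finite V"
    and nonempty_vertices: "V \<noteq> {}"
    and edges_subset: "E \<subseteq> Pow V"
    and vertices_covered: "\<And>v. v \<in> V \<Longrightarrow> \<exists>e\<in>E. v \<in> e"

(* A model V \<Rightarrow> [0,1] is a total function of which only the values on V matter. *)
definition probabilistic_models :: "'a set \<Rightarrow> 'a set set \<Rightarrow> ('a \<Rightarrow> real) set" where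
  "probabilistic_models V E = {p. p \<in> V \<rightarrow> {0..1} \<and> (\<forall>e\<in>E. (\<Sum>v\<in>e. p v) = 1)}"

(* A real matrix with rows and columns indexed by a finite set I is a function of two
   arguments of which only the values on I \<times> I matter. *)
definition psd_on :: "'i set \<Rightarrow> ('i \<Rightarrow> 'i \<Rightarrow> real) \<Rightarrow> bool" where
  "psd_on I M \<longleftrightarrow>
     (\<forall>i\<in>I. \<forall>j\<in>I. M i j = M j i) \<and>
     (\<forall>x :: 'i \<Rightarrow> real. 0 \<le> (\<Sum>i\<in>I. \<Sum>j\<in>I. x i * M i j * x j))"

(* The index set is V together with one additional index; a vertex v is encoded as
   Some v, and the special index 1 as None. *)
definition Q1_certificate ::
  "'a set \<Rightarrow> 'a set set \<Rightarrow> ('a \<Rightarrow> real) \<Rightarrow> ('a option \<Rightarrow> 'a option \<Rightarrow> real) \<Rightarrow> bool" where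
  "Q1_certificate V E p M \<longleftrightarrow>
     psd_on (insert None (Some ` V)) M \<and>
     (\<forall>e\<in>E. \<forall>v\<in>V. (\<Sum>u\<in>e. M (Some u) (Some v)) = M None (Some v)) \<and>
     (\<forall>e\<in>E. (\<Sum>v\<in>e. M None (Some v)) = M None None) \<and>
     (\<forall>e\<in>E. \<forall>u\<in>e. \<forall>v\<in>e. u \<noteq> v \<longrightarrow> M (Some u) (Some v) = 0) \<and>
     (\<forall>v\<in>V. M (Some v) (Some v) = p v)"

definition Q1 :: "'a set \<Rightarrow> 'a set set \<Rightarrow> ('a \<Rightarrow> real) set" where
  "Q1 V E = {p \<in> probabilistic_models V E. \<exists>M. Q1_certificate V E p M}"

definition macroscopic_noncontextuality_certificate ::
  "'a set \<Rightarrow> 'a set set \<Rightarrow> ('a \<Rightarrow> real) \<Rightarrow> ('a \<Rightarrow> 'a \<Rightarrow> real) \<Rightarrow> bool" where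
  "macroscopic_noncontextuality_certificate V E p \<gamma> \<longleftrightarrow>
     psd_on V \<gamma> \<and>
     (\<forall>e\<in>E. \<forall>v\<in>V. (\<Sum>u\<in>e. \<gamma> u v) = 0) \<and>
     (\<forall>u\<in>V. \<forall>v\<in>V. u \<noteq> v \<and> (\<exists>e\<in>E. u \<in> e \<and> v \<in> e) \<longrightarrow> \<gamma> u v = - (p u * p v)) \<and>
     (\<forall>v\<in>V. \<gamma> v v = p v - (p v)\<^sup>2)"

definition macroscopically_noncontextual ::
  "'a set \<Rightarrow> 'a set set \<Rightarrow> ('a \<Rightarrow> real) \<Rightarrow> bool" where
  "macroscopically_noncontextual V E p \<longleftrightarrow>
     (\<exists>\<gamma>. macroscopic_noncontextuality_certificate V E p \<gamma>)"

end

theory Submission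
  imports Defs
begin

text \<open>
  In a \<open>\<Q>\<^sub>1\<close> certificate the row of the special index is forced to be \<open>p\<close>, with corner entry 1:
  in the column of \<open>v\<close>, summing over an edge through \<open>v\<close> leaves only the diagonal entry \<open>p v\<close>.
  Hence the two kinds of certificates correspond via \<open>\<gamma> u v = M u v - p u * p v\<close>, the Schur
  complement of the corner, and this complement is p.s.d. iff \<open>M\<close> is.
\<close>

lemma psd_on_sym: "psd_on I M \<Longrightarrow> i \<in> I \<Longrightarrow> j \<in> I \<Longrightarrow> M i j = M j i"
  unfolding psd_on_def by blast

lemma psd_on_cong:
  assumes "\<And>i j. i \<in> I \<Longrightarrow> j \<in> I \<Longrightarrow> M i j = N i j"
  shows "psd_on I M \<longleftrightarrow> psd_on I N"
proof -
  have "(\<Sum>i\<in>I. \<Sum>j\<in>I. x i * M i j * x j) = (\<Sum>i\<in>I. \<Sum>j\<in>I. x i * N i j * x j)" for x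
    using assms by (intro sum.cong) auto
  moreover have "(\<forall>i\<in>I. \<forall>j\<in>I. M i j = M j i) \<longleftrightarrow> (\<forall>i\<in>I. \<forall>j\<in>I. N i j = N j i)"
    using assms by metis
  ultimately show ?thesis
    by (simp only: psd_on_def)
qed

lemma Q1_certificateD:
  assumes "Q1_certificate V E p M"
  shows "psd_on (insert None (Some ` V)) M"
    and "\<And>e v. e \<in> E \<Longrightarrow> v \<in> V \<Longrightarrow> (\<Sum>u\<in>e. M (Some u) (Some v)) = M None (Some v)"
    and "\<And>e. e \<in> E \<Longrightarrow> (\<Sum>v\<in>e. M None (Some v)) = M None None"
    and "\<And>e u v. e \<in> E \<Longrightarrow> u \<in> e \<Longrightarrow> v \<in> e \<Longrightarrow> u \<noteq> v \<Longrightarrow> M (Some u) (Some v) = 0"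
    and "\<And>v. v \<in> V \<Longrightarrow> M (Some v) (Some v) = p v"
  using assms unfolding Q1_certificate_def by blast+

text \<open>Completing the square in the variable \<open>x None\<close>: with corner 1 and a
  symmetric border, all terms containing \<open>x None\<close> fit into one square, and the rank-one
  surplus of that square is what turns the block on \<open>I\<close> into its Schur
  complement.\<close>

lemma quadratic_form_border:
  fixes M :: "'a option \<Rightarrow> 'a option \<Rightarrow> real"
  assumes "finite I" and corner: "M None None = 1"
    and border: "\<And>v. v \<in> I \<Longrightarrow> M (Some v) None = M None (Some v)"
  shows "(\<Sum>i\<in>insert None (Some ` I). \<Sum>j\<in>insert None (Some ` I). x i * M i j * x j) =
      (x None + (\<Sum>v\<in>I. x (Some v) * M None (Some v)))\<^sup>2 +
      (\<Sum>u\<in>I. \<Sum>v\<in>I. x (Some u) *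
        (M (Some u) (Some v) - M None (Some u) * M None (Some v)) * x (Some v))"
proof -
  define s where "s = (\<Sum>v\<in>I. x (Some v) * M None (Some v))"
  have sum_option: "(\<Sum>i\<in>insert None (Some ` I). f i) = f None + (\<Sum>v\<in>I. f (Some v))"
    for f :: "'a option \<Rightarrow> real"
    using \<open>finite I\<close> by (simp add: sum.reindex image_iff)
  have row: "(\<Sum>v\<in>I. x None * M None (Some v) * x (Some v)) = x None * s"
    by (simp add: s_def sum_distrib_left ac_simps)
  \<comment> \<open>Symmetry of the border makes this equal to the row contribution, hence the cross
    term \<open>2 * (x None * s)\<close>.\<close>
  have col: "(\<Sum>u\<in>I. x (Some u) * M (Some u) None * x None) = x None * s"
    by (simp add: s_def sum_distrib_left border ac_simps)
  \<comment> \<open>The square of \<open>s\<close> is the quadratic form of the rank-one matrix that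
    the Schur complement subtracts.\<close>
  have "s * s = (\<Sum>u\<in>I. \<Sum>v\<in>I. x (Some u) * (M None (Some u) * M None (Some v)) * x (Some v))"
    by (simp add: s_def sum_product ac_simps)
  then have "(\<Sum>u\<in>I. \<Sum>v\<in>I. x (Some u) *
        (M (Some u) (Some v) - M None (Some u) * M None (Some v)) * x (Some v)) =
      (\<Sum>u\<in>I. \<Sum>v\<in>I. x (Some u) * M (Some u) (Some v) * x (Some v)) - s * s"
    by (simp add: sum_subtractf right_diff_distrib left_diff_distrib)
  moreover have "(\<Sum>i\<in>insert None (Some ` I). \<Sum>j\<in>insert None (Some ` I). x i * M i j * x j) =
      (x None)\<^sup>2 + 2 * (x None * s) +
      (\<Sum>u\<in>I. \<Sum>v\<in>I. x (Some u) * M (Some u) (Some v) * x (Some v))"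
    by (simp only: sum_option sum.distrib row col corner) (simp add: power2_eq_square)
  ultimately show ?thesis
    by (simp add: s_def [symmetric] power2_eq_square algebra_simps)
qed

text \<open>The form of \<open>M\<close> is a square plus the form of the complement, so
  nonnegativity passes from the complement to \<open>M\<close>. Conversely, every vector on
  \<open>I\<close> extends to one at which the square is zero.\<close>

lemma psd_on_border_iff:
  fixes M :: "'a option \<Rightarrow> 'a option \<Rightarrow> real"
  assumes "finite I" and "M None None = 1"
    and border: "\<And>v. v \<in> I \<Longrightarrow> M (Some v) None = M None (Some v)"
  shows "psd_on (insert None (Some ` I)) M \<longleftrightarrow>
    psd_on I (\<lambda>u v. M (Some u) (Some v) - M None (Some u) * M None (Some v))"
    (is "psd_on ?J M \<longleftrightarrow> psd_on I ?C")
proof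
  assume psd: "psd_on ?J M"
  show "psd_on I ?C"
    unfolding psd_on_def
  proof (intro conjI allI)
    show "\<forall>i\<in>I. \<forall>j\<in>I. ?C i j = ?C j i"
    proof (intro ballI)
      fix i j assume "i \<in> I" "j \<in> I"
      then have "M (Some i) (Some j) = M (Some j) (Some i)"
        by (intro psd_on_sym [OF psd]) auto
      then show "?C i j = ?C j i"
        by (simp add: mult.commute)
    qed
    fix y :: "'a \<Rightarrow> real"
    \<comment> \<open>the value at \<open>None\<close> that makes the square in \<open>quadratic_form_border\<close> vanish\<close>
    define x where "x = case_option (- (\<Sum>v\<in>I. y v * M None (Some v))) y"
    have "0 \<le> (\<Sum>i\<in>?J. \<Sum>j\<in>?J. x i * M i j * x j)"
      using psd by (simp only: psd_on_def)
    then show "0 \<le> (\<Sum>i\<in>I. \<Sum>j\<in>I. y i * ?C i j * y j)"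
      using quadratic_form_border [OF assms, of x] by (simp add: x_def)
  qed
next
  assume psd: "psd_on I ?C"
  show "psd_on ?J M"
    unfolding psd_on_def
  proof (intro conjI allI)
    show "\<forall>i\<in>?J. \<forall>j\<in>?J. M i j = M j i"
    proof (intro ballI)
      fix i j assume ij: "i \<in> ?J" "j \<in> ?J"
      show "M i j = M j i"
      proof (cases "i = None \<or> j = None")
        case True
        then show ?thesis
          using ij border by auto
      next
        case False
        then obtain u v where uv: "i = Some u" "j = Some v" "u \<in> I" "v \<in> I"
          using ij by blast
        \<comment> \<open>The subtracted product is symmetric in \<open>u\<close> and
          \<open>v\<close>, so the symmetry of \<open>?C\<close> carries back to
          \<open>M\<close>.\<close>
        then show ?thesis
          using psd_on_sym [OF psd uv(3,4)] by (simp add: mult.commute)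
      qed
    qed
    fix x :: "'a option \<Rightarrow> real"
    have "0 \<le> (\<Sum>i\<in>I. \<Sum>j\<in>I. x (Some i) * ?C i j * x (Some j))"
      using conjunct2 [OF psd [unfolded psd_on_def], THEN spec, of "\<lambda>v. x (Some v)"] .
    then show "0 \<le> (\<Sum>i\<in>?J. \<Sum>j\<in>?J. x i * M i j * x j)"
      using quadratic_form_border [OF assms, of x] by simp
  qed
qed

context contextuality_scenario
begin

lemma edge_subset: "e \<in> E \<Longrightarrow> e \<subseteq> V"
  using edges_subset by blast

lemma finite_edge: "e \<in> E \<Longrightarrow> finite e"
  using edge_subset finite_vertices finite_subset by blast

lemma Q1_certificate_border:
  assumes "Q1_certificate V E p M" and "v \<in> V"
  shows "M None (Some v) = p v"
proof -
  obtain e where e: "e \<in> E" "v \<in> e"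
    using vertices_covered assms(2) by blast
  have "M None (Some v) = (\<Sum>u\<in>e. M (Some u) (Some v))"
    using Q1_certificateD(2) [OF assms(1) e(1) assms(2)] by simp
  also have "\<dots> = (\<Sum>u\<in>e. if u = v then p v else 0)"
    using Q1_certificateD(4,5) [OF assms(1)] assms(2) e by (intro sum.cong) auto
  also have "\<dots> = p v"
    using e finite_edge by simp
  finally show ?thesis .
qed

text \<open>Since \<open>V\<close> is nonempty and covered, some edge exists. The border equals
  \<open>p\<close> along it, so normalisation of the model fixes the corner.\<close>

lemma Q1_certificate_corner:
  assumes "Q1_certificate V E p M" and "p \<in> probabilistic_models V E"
  shows "M None None = 1"
proof -
  obtain e where e: "e \<in> E"
    using nonempty_vertices vertices_covered by blast
  then have "M None None = (\<Sum>v\<in>e. M None (Some v))"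
    using Q1_certificateD(3) [OF assms(1)] by simp
  also have "\<dots> = (\<Sum>v\<in>e. p v)"
    using Q1_certificate_border [OF assms(1)] edge_subset [OF e] by (intro sum.cong) auto
  also have "\<dots> = 1"
    using assms(2) e by (simp add: probabilistic_models_def)
  finally show ?thesis .
qed

lemma macroscopic_noncontextuality_certificate_of_Q1:
  assumes cert: "Q1_certificate V E p M" and p: "p \<in> probabilistic_models V E"
  shows "macroscopic_noncontextuality_certificate V E p (\<lambda>u v. M (Some u) (Some v) - p u * p v)"
    (is "macroscopic_noncontextuality_certificate V E p ?\<gamma>")
proof -
  note border = Q1_certificate_border [OF cert]
  have psd: "psd_on (insert None (Some ` V)) M"
    using cert by (rule Q1_certificateD)
  then have "M (Some v) None = M None (Some v)" if "v \<in> V" for v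
    using that by (intro psd_on_sym) auto
  note psd_on_border_iff [where M = M, OF finite_vertices Q1_certificate_corner [OF cert p] this]
  then have "psd_on V (\<lambda>u v. M (Some u) (Some v) - M None (Some u) * M None (Some v))"
    using psd by blast
  \<comment> \<open>The border is known to equal \<open>p\<close> only on \<open>V\<close>, so the
    two matrices are exchanged by congruence on the index set.\<close>
  also have "?this \<longleftrightarrow> psd_on V ?\<gamma>"
    by (intro psd_on_cong) (simp add: border)
  finally have "psd_on V ?\<gamma>" .
  moreover have "(\<Sum>u\<in>e. ?\<gamma> u v) = 0" if "e \<in> E" "v \<in> V" for e v
  proof -
    \<comment> \<open>Normalisation reduces the right-hand side to
      \<open>p v - 1 * p v\<close>.\<close>
    have "(\<Sum>u\<in>e. ?\<gamma> u v) = M None (Some v) - (\<Sum>u\<in>e. p u) * p v"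
      using Q1_certificateD(2) [OF cert that] by (simp add: sum_subtractf sum_distrib_right)
    then show ?thesis
      using p that by (simp add: probabilistic_models_def border)
  qed
  moreover have "?\<gamma> u v = - (p u * p v)" if "u \<noteq> v" "\<exists>e\<in>E. u \<in> e \<and> v \<in> e" for u v
    using Q1_certificateD(4) [OF cert] that by auto
  moreover have "?\<gamma> v v = p v - (p v)\<^sup>2" if "v \<in> V" for v
    using Q1_certificateD(5) [OF cert that] by (simp add: power2_eq_square)
  ultimately show ?thesis
    unfolding macroscopic_noncontextuality_certificate_def by (intro conjI ballI impI) simp_all
qed

text \<open>\<open>M\<close> is built with corner 1 and border \<open>p\<close> so that its Schur
  complement is exactly \<open>\<gamma>\<close>; positivity then follows from
  \<open>psd_on_border_iff\<close>.\<close>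

lemma Q1_certificate_of_macroscopic_noncontextuality:
  assumes cert: "macroscopic_noncontextuality_certificate V E p \<gamma>"
    and p: "p \<in> probabilistic_models V E"
  defines "M \<equiv> \<lambda>i j. case (i, j) of
      (Some u, Some v) \<Rightarrow> \<gamma> u v + p u * p v
    | (None, Some v) \<Rightarrow> p v
    | (Some u, None) \<Rightarrow> p u
    | (None, None) \<Rightarrow> 1"
  shows "Q1_certificate V E p M"
proof -
  have "psd_on (insert None (Some ` V)) M"
    using psd_on_border_iff [OF finite_vertices, of M] cert
    by (simp add: M_def macroscopic_noncontextuality_certificate_def)
  \<comment> \<open>The \<open>\<gamma>\<close> part sums to 0 over an edge, and the product part
    sums to \<open>1 * p v\<close>.\<close>
  moreover have "(\<Sum>u\<in>e. M (Some u) (Some v)) = M None (Some v)" if "e \<in> E" "v \<in> V" for e v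
    using cert p that
    by (simp add: M_def macroscopic_noncontextuality_certificate_def probabilistic_models_def
        sum.distrib flip: sum_distrib_right)
  moreover have "(\<Sum>v\<in>e. M None (Some v)) = M None None" if "e \<in> E" for e
    using p that by (simp add: M_def probabilistic_models_def)
  moreover have "M (Some u) (Some v) = 0" if "e \<in> E" "u \<in> e" "v \<in> e" "u \<noteq> v" for e u v
  proof -
    \<comment> \<open>On a common edge \<open>\<gamma>\<close> cancels the added product
      exactly.\<close>
    have "\<gamma> u v = - (p u * p v)"
      using cert that edge_subset [OF that(1)]
      unfolding macroscopic_noncontextuality_certificate_def by blast
    then show ?thesis
      by (simp add: M_def)
  qed
  moreover have "M (Some v) (Some v) = p v" if "v \<in> V" for v
    using cert that
    by (simp add: M_def macroscopic_noncontextuality_certificate_def power2_eq_square)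
  ultimately show ?thesis
    by (simp add: Q1_certificate_def)
qed

end

theorem theorem7:
  fixes V :: "'a set" and E :: "'a set set" and p :: "'a \<Rightarrow> real"
  assumes "contextuality_scenario V E"
    and "p \<in> probabilistic_models V E"
  shows "macroscopically_noncontextual V E p \<longleftrightarrow> p \<in> Q1 V E"
proof -
  interpret contextuality_scenario V E by (fact assms(1))
  show ?thesis
    using assms(2) macroscopic_noncontextuality_certificate_of_Q1
      Q1_certificate_of_macroscopic_noncontextuality
    unfolding macroscopically_noncontextual_def Q1_def by blast
qed

end
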